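(* Let $G=(B,\circ)$ be a group, let $\mathcal S$ be the class of semi-braces having $G$ as multiplicative group (i.e. of semi-braces $(B,+,\circ)$ with the given $\circ$), and let $\mathcal A$ be the class of affine structures on $G$. Then the map $\psi:\mathcal S\to\mathcal A$ sending a semi-brace $B=(B,+,\circ)$ to its associated affine structure $\sigma^B$, $\sigma^B_a(b)=a^-\circ(a+b)$, is a bijection.
   Context: For a group $G=(B,\circ)$, $0$ denotes its identity and $a^-$ the inverse of $a$. $B^B$ is the monoid (under composition) of all maps $B\to B$. For $\sigma:B\to B^B$ write $\sigma_a:=\sigma(a)$; juxtaposition of maps is composition. An affine structure on $G$ is a map $\sigma:B\to B^B$ that is a semigroup anti-homomorphism, i.e. $\sigma_{a\circ b}=\sigma_b\sigma_a$ for all $a,b\in B$ (it is not required that $\sigma_0=\mathrm{id}_B$), such that $\sigma_a(b\circ\sigma_b(c))=\sigma_a(b)\circ\sigma_{\sigma_a(b)}\sigma_a(c)$ for all $a,b,c\in B$. A (left) semi-brace is a set $B$ with two binary operations $+,\circ$ such that $(B,+)$ is a semigroup, $(B,\circ)$ is a group (the multiplicative group), and $a\circ(b+c)=a\circ b+a\circ(a^-+c)$ for all $a,b,c\in B$ ($\circ$ has higher precedence than $+$). The affine structure associated to a semi-brace $B$ is $\sigma^B:B\to B^B$, $a\mapsto\lambda_{a^-}$, where $\lambda_a(b)=a\circ(a^-+b)$; explicitly $\sigma^B_a(b)=a^-\circ(a+b)$. *)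

theory Defs
  imports "HOL-Algebra.Group"
begin

text \<open>
  Operations and maps are normalised to be extensional on the carrier (\<open>\<rightarrow>\<^sub>E\<close>), so that
  equality in HOL coincides with equality on the underlying set.
\<close>

record 'a semi_brace = "'a monoid" +
  sb_add :: "['a, 'a] \<Rightarrow> 'a" (infixl \<open>\<oplus>\<index>\<close> 65)

locale semi_brace = group S for S :: "('a, 'm) semi_brace_scheme" (structure) +
  assumes sb_add_closed: "sb_add S \<in> carrier S \<rightarrow>\<^sub>E (carrier S \<rightarrow>\<^sub>E carrier S)"
    and sb_add_assoc:
      "\<lbrakk>a \<in> carrier S; b \<in> carrier S; c \<in> carrier S\<rbrakk> \<Longrightarrow> (a \<oplus> b) \<oplus> c = a \<oplus> (b \<oplus> c)"
    and sb_distrib: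
      "\<lbrakk>a \<in> carrier S; b \<in> carrier S; c \<in> carrier S\<rbrakk>
        \<Longrightarrow> a \<otimes> (b \<oplus> c) = a \<otimes> b \<oplus> a \<otimes> (inv a \<oplus> c)"

text \<open>
  The anti-homomorphism goes into the maps of the carrier to itself under
  \<^const>\<open>compose\<close>; it is not required to send the identity to the identity map.
\<close>

locale affine_structure = group G for G :: "('a, 'm) monoid_scheme" (structure) +
  fixes \<sigma> :: "'a \<Rightarrow> 'a \<Rightarrow> 'a"
  assumes affine_closed: "\<sigma> \<in> carrier G \<rightarrow>\<^sub>E (carrier G \<rightarrow>\<^sub>E carrier G)"
    and affine_antihom:
      "\<lbrakk>a \<in> carrier G; b \<in> carrier G\<rbrakk> \<Longrightarrow> \<sigma> (a \<otimes> b) = compose (carrier G) (\<sigma> b) (\<sigma> a)"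
    and affine_cond:
      "\<lbrakk>a \<in> carrier G; b \<in> carrier G; c \<in> carrier G\<rbrakk>
        \<Longrightarrow> \<sigma> a (b \<otimes> \<sigma> b c) = \<sigma> a b \<otimes> \<sigma> (\<sigma> a b) (\<sigma> a c)"

definition sb_lambda :: "('a, 'm) semi_brace_scheme \<Rightarrow> 'a \<Rightarrow> 'a \<Rightarrow> 'a" where
  "sb_lambda S a = (\<lambda>b\<in>carrier S. a \<otimes>\<^bsub>S\<^esub> (inv\<^bsub>S\<^esub> a \<oplus>\<^bsub>S\<^esub> b))"

definition associated_affine :: "('a, 'm) semi_brace_scheme \<Rightarrow> 'a \<Rightarrow> 'a \<Rightarrow> 'a" where
  "associated_affine S = (\<lambda>a\<in>carrier S. sb_lambda S (inv\<^bsub>S\<^esub> a))"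

lemma (in semi_brace) associated_affine_apply:
  assumes "a \<in> carrier S" "b \<in> carrier S"
  shows "associated_affine S a b = inv a \<otimes> (a \<oplus> b)"
  using assms by (simp add: associated_affine_def sb_lambda_def)

definition semi_braces_on :: "'a monoid \<Rightarrow> 'a semi_brace set" where
  "semi_braces_on G = {S. semi_brace S \<and> monoid.truncate S = G}"

definition affine_structures_on :: "'a monoid \<Rightarrow> ('a \<Rightarrow> 'a \<Rightarrow> 'a) set" where
  "affine_structures_on G = {\<sigma>. affine_structure G \<sigma>}"

end

theory Submission
  imports Defs
begin

text \<open>
  The two structures are linked by \<open>a + b = a \<circ> \<sigma>\<^sub>a(b)\<close>. Under this relation, associativity of \<open>+\<close>
  becomes the second axiom for \<open>\<sigma>\<close>, and the semi-brace identity
  \<open>a \<circ> (b + c) = a \<circ> b + \<lambda>\<^sub>a(c)\<close> becomes the anti-homomorphism property. Recovering the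
  semi-brace identity does not need \<open>\<sigma>\<^sub>0 = id\<close>, because \<open>\<sigma>\<^sub>b \<sigma>\<^sub>a \<sigma>\<^sub>a\<^sub>\<^sup>- = \<sigma>\<^sub>b \<sigma>\<^sub>0 = \<sigma>\<^sub>b\<close>.
\<close>

text \<open>\<open>semi_braces_on G\<close> ties a semi-brace to \<open>G\<close> through
  \<open>monoid.truncate\<close>. These rules let facts proved about \<open>S\<close> itself be read
  as facts about \<open>G\<close>, since inverses and the predicates involved depend only on the
  monoid fields.\<close>

lemma carrier_truncate [simp]: "carrier (monoid.truncate S) = carrier S"
  and mult_truncate [simp]: "mult (monoid.truncate S) = mult S"
  and one_truncate [simp]: "one (monoid.truncate S) = one S"
  by (simp_all add: monoid.defs)

lemma m_inv_truncate [simp]: "m_inv (monoid.truncate S) = m_inv S"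
  by (simp add: fun_eq_iff m_inv_def)

lemma group_truncate [simp]: "group (monoid.truncate S) \<longleftrightarrow> group S"
  unfolding group_def monoid_def group_axioms_def Units_def
    carrier_truncate mult_truncate one_truncate ..

lemma affine_structure_truncate [simp]:
  "affine_structure (monoid.truncate S) \<sigma> \<longleftrightarrow> affine_structure S \<sigma>"
  unfolding affine_structure_def affine_structure_axioms_def
    carrier_truncate mult_truncate group_truncate ..

context semi_brace
begin

lemma add_closed [simp, intro]:
  "\<lbrakk>a \<in> carrier S; b \<in> carrier S\<rbrakk> \<Longrightarrow> a \<oplus> b \<in> carrier S"
  using sb_add_closed by blast

lemma add_eq_mult_associated_affine:
  assumes "a \<in> carrier S" "b \<in> carrier S"
  shows "a \<oplus> b = a \<otimes> associated_affine S a b"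
  using assms by (simp add: associated_affine_apply flip: m_assoc)

lemma associated_affine_closed:
  "associated_affine S \<in> carrier S \<rightarrow>\<^sub>E (carrier S \<rightarrow>\<^sub>E carrier S)"
  by (auto simp: associated_affine_def sb_lambda_def)

lemma affine_structure_associated_affine: "affine_structure S (associated_affine S)"
proof unfold_locales
  show "associated_affine S \<in> carrier S \<rightarrow>\<^sub>E (carrier S \<rightarrow>\<^sub>E carrier S)"
    by (rule associated_affine_closed)
next
  fix a b assume ab: "a \<in> carrier S" "b \<in> carrier S"
  show "associated_affine S (a \<otimes> b)
      = compose (carrier S) (associated_affine S b) (associated_affine S a)"
  proof (rule extensionalityI)
    show "associated_affine S (a \<otimes> b) \<in> extensional (carrier S)"
      using ab by (simp add: associated_affine_def sb_lambda_def)
  next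
    fix c assume c: "c \<in> carrier S"
    have "associated_affine S (a \<otimes> b) c = inv b \<otimes> (inv a \<otimes> (a \<otimes> b \<oplus> c))"
      using ab c by (simp add: associated_affine_apply inv_mult_group m_assoc)
    \<comment> \<open>The semi-brace identity for left multiplication by \<open>inv a\<close>: the
      first summand cancels to \<open>b\<close>, and the double inverse in the second collapses to
      \<open>a\<close>.\<close>
    also have "inv a \<otimes> (a \<otimes> b \<oplus> c) = b \<oplus> inv a \<otimes> (a \<oplus> c)"
      using ab c sb_distrib[of "inv a" "a \<otimes> b" c] by (simp flip: m_assoc)
    finally show "associated_affine S (a \<otimes> b) c
        = compose (carrier S) (associated_affine S b) (associated_affine S a) c"
      using ab c by (simp add: compose_eq associated_affine_apply)
  qed (simp add: compose_extensional)
next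
  fix a b c assume abc: "a \<in> carrier S" "b \<in> carrier S" "c \<in> carrier S"
  let ?\<sigma> = "associated_affine S"
  have cl: "?\<sigma> a b \<in> carrier S" "?\<sigma> a c \<in> carrier S"
    using abc by (simp_all add: associated_affine_apply)
  \<comment> \<open>Both sides of the second axiom equal \<open>inv a\<close> times the triple sum
    of a, b, c. Unfolding only at \<open>a\<close> leaves the inner product free to be folded back
    into \<open>b \<oplus> c\<close>.\<close>
  have "?\<sigma> a (b \<otimes> ?\<sigma> b c) = inv a \<otimes> ((a \<oplus> b) \<oplus> c)"
    using abc by (simp add: associated_affine_apply[of a] sb_add_assoc
        flip: add_eq_mult_associated_affine)
  also have "\<dots> = ?\<sigma> a b \<oplus> ?\<sigma> a c"
    using abc sb_distrib[of "inv a" "a \<oplus> b" c] by (simp add: associated_affine_apply)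
  finally show "?\<sigma> a (b \<otimes> ?\<sigma> b c) = ?\<sigma> a b \<otimes> ?\<sigma> (?\<sigma> a b) (?\<sigma> a c)"
    using cl by (simp add: add_eq_mult_associated_affine)
qed

end

text \<open>Extending the record \<open>G\<close> itself makes truncation return exactly
  \<open>G\<close>; the restrictions make the sum extensional, as \<open>sb_add_closed\<close>
  demands.\<close>

definition semi_brace_of_affine :: "'a monoid \<Rightarrow> ('a \<Rightarrow> 'a \<Rightarrow> 'a) \<Rightarrow> 'a semi_brace" where
  "semi_brace_of_affine G \<sigma> = monoid.extend G
     (semi_brace.fields (\<lambda>a\<in>carrier G. \<lambda>b\<in>carrier G. a \<otimes>\<^bsub>G\<^esub> \<sigma> a b))"

lemma truncate_semi_brace_of_affine [simp]:
  "monoid.truncate (semi_brace_of_affine G \<sigma>) = G"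
  by (simp add: semi_brace_of_affine_def monoid.defs semi_brace.defs)

lemma semi_brace_of_affine_simps [simp]:
  "carrier (semi_brace_of_affine G \<sigma>) = carrier G"
  "mult (semi_brace_of_affine G \<sigma>) = mult G"
  "one (semi_brace_of_affine G \<sigma>) = one G"
  "m_inv (semi_brace_of_affine G \<sigma>) = m_inv G"
  "group (semi_brace_of_affine G \<sigma>) \<longleftrightarrow> group G"
  by (metis carrier_truncate mult_truncate one_truncate m_inv_truncate group_truncate
      truncate_semi_brace_of_affine)+

lemma sb_add_semi_brace_of_affine [simp]:
  "sb_add (semi_brace_of_affine G \<sigma>) = (\<lambda>a\<in>carrier G. \<lambda>b\<in>carrier G. a \<otimes>\<^bsub>G\<^esub> \<sigma> a b)"
  by (simp add: semi_brace_of_affine_def monoid.defs semi_brace.defs)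

text \<open>Half of the inverse property. The locale allows records with further fields, which the
  construction forgets; hence \<open>semi_brace.truncate\<close> on the right.\<close>

lemma (in semi_brace) semi_brace_of_associated_affine:
  "semi_brace_of_affine (monoid.truncate S) (associated_affine S) = semi_brace.truncate S"
proof -
  have "(\<lambda>a\<in>carrier S. \<lambda>b\<in>carrier S. a \<otimes> associated_affine S a b) = sb_add S"
  proof (rule extensionalityI)
    show "sb_add S \<in> extensional (carrier S)"
      using sb_add_closed by (auto simp: PiE_def)
  next
    fix a assume a: "a \<in> carrier S"
    then have "sb_add S a \<in> extensional (carrier S)"
      using sb_add_closed by (auto simp: PiE_def)
    with a show "(\<lambda>a\<in>carrier S. \<lambda>b\<in>carrier S. a \<otimes> associated_affine S a b) a = sb_add S a"
      by (auto simp flip: add_eq_mult_associated_affine intro!: extensionalityI[of _ "carrier S"])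
  qed simp
  then show ?thesis
    by (simp add: semi_brace_of_affine_def monoid.defs semi_brace.defs)
qed

context affine_structure
begin

lemma affine_app_closed [simp, intro]:
  "\<lbrakk>a \<in> carrier G; b \<in> carrier G\<rbrakk> \<Longrightarrow> \<sigma> a b \<in> carrier G"
  using affine_closed by blast

lemma affine_mult_app:
  "\<lbrakk>a \<in> carrier G; b \<in> carrier G; c \<in> carrier G\<rbrakk> \<Longrightarrow> \<sigma> (a \<otimes> b) c = \<sigma> b (\<sigma> a c)"
  by (simp add: affine_antihom compose_eq)

end

lemma semi_brace_semi_brace_of_affine:
  fixes G :: "'a monoid"
  assumes "affine_structure G \<sigma>"
  shows "semi_brace (semi_brace_of_affine G \<sigma>)"
proof -
  interpret affine_structure G \<sigma> by fact
  have "group (semi_brace_of_affine G \<sigma>)"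
    by (simp add: is_group)
  moreover have "semi_brace_axioms (semi_brace_of_affine G \<sigma>)"
  proof (unfold_locales, goal_cases)
    case 1
    show ?case by auto
  next
    \<comment> \<open>Associativity: (a + b) + c expands to a \<circ> x \<circ> \<sigma>(a \<circ>
      x)(c) with x = \<sigma>(a)(b). The anti-homomorphism law splits the last factor into
      \<sigma>(x)(\<sigma>(a)(c)), and \<open>affine_cond\<close> then applies.\<close>
    case (2 a b c)
    then show ?case by (simp add: m_assoc affine_cond affine_mult_app)
  next
    case (3 a b c)
    then have abc: "a \<in> carrier G" "b \<in> carrier G" "c \<in> carrier G"
      by simp_all
    then have cancel: "a \<otimes>\<^bsub>G\<^esub> (inv\<^bsub>G\<^esub> a \<otimes>\<^bsub>G\<^esub> x) = x" "inv\<^bsub>G\<^esub> a \<otimes>\<^bsub>G\<^esub> (a \<otimes>\<^bsub>G\<^esub> x) = x"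
      if "x \<in> carrier G" for x
      using that by (simp_all flip: m_assoc)
    \<comment> \<open>After cancelling \<open>a\<close> against its inverse, the right side of the
      semi-brace identity is a \<circ> b times the left side here. The index on the right here
      reduces to \<open>b\<close>, which gives a \<circ> (b + c).\<close>
    have "\<sigma> (a \<otimes>\<^bsub>G\<^esub> b) (\<sigma> (inv\<^bsub>G\<^esub> a) c) = \<sigma> (inv\<^bsub>G\<^esub> a \<otimes>\<^bsub>G\<^esub> (a \<otimes>\<^bsub>G\<^esub> b)) c"
      using abc by (simp only: affine_mult_app inv_closed m_closed)
    with abc show ?case
      by (simp add: cancel m_assoc)
  qed
  ultimately show ?thesis
    by (rule semi_brace.intro)
qed

text \<open>The other half: on the carrier, \<open>inv a\<close> cancels the factor \<open>a\<close>
  in the sum. Off the carrier, extensionality in each of the two arguments gives equality.\<close>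

lemma associated_affine_semi_brace_of_affine:
  fixes G :: "'a monoid"
  assumes "affine_structure G \<sigma>"
  shows "associated_affine (semi_brace_of_affine G \<sigma>) = \<sigma>"
proof -
  interpret affine_structure G \<sigma> by fact
  show ?thesis
  proof (rule extensionalityI)
    show "\<sigma> \<in> extensional (carrier G)"
      using affine_closed by (auto simp: PiE_def)
  next
    fix a assume a: "a \<in> carrier G"
    then have "\<sigma> a \<in> extensional (carrier G)"
      using affine_closed by (auto simp: PiE_def)
    with a show "associated_affine (semi_brace_of_affine G \<sigma>) a = \<sigma> a"
      by (auto simp: associated_affine_def sb_lambda_def simp flip: m_assoc
          intro!: extensionalityI[of _ "carrier G"])
  qed (simp add: associated_affine_def)
qed

theorem corollary11:
  fixes G :: "'a monoid"
  assumes "group G"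
  shows "bij_betw associated_affine (semi_braces_on G) (affine_structures_on G)"
proof (rule bij_betw_byWitness[where f' = "semi_brace_of_affine G"])
  \<comment> \<open>On the type \<open>'a semi_brace\<close> there are no further fields, so
    \<open>semi_brace.truncate\<close> is the identity.\<close>
  show "\<forall>S\<in>semi_braces_on G. semi_brace_of_affine G (associated_affine S) = S"
    by (auto simp: semi_braces_on_def semi_brace.semi_brace_of_associated_affine semi_brace.defs)
  show "\<forall>\<sigma>\<in>affine_structures_on G. associated_affine (semi_brace_of_affine G \<sigma>) = \<sigma>"
    by (simp add: affine_structures_on_def associated_affine_semi_brace_of_affine)
  show "associated_affine ` semi_braces_on G \<subseteq> affine_structures_on G"
    by (auto simp: semi_braces_on_def affine_structures_on_def
        semi_brace.affine_structure_associated_affine)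
  show "semi_brace_of_affine G ` affine_structures_on G \<subseteq> semi_braces_on G"
    by (auto simp: semi_braces_on_def affine_structures_on_def semi_brace_semi_brace_of_affine)
qed

end
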